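(* Let $F$ be a singular fiber of Kodaira type $I_n^*$, $n\geq1$, of an elliptic fibration on a smooth $K3$ surface, written $$F=C_0'+C_0''+2C_0+2C_1+\cdots+2C_n+C_n'+C_n''.$$ Let $R$ be an ADER in $F$ with $C_0,C_n\not\subset\operatorname{Supp}(R)$. Then every connected component of $R$ is of type $A_k$ for some $k$. More precisely, one of the following holds. (1) If $\operatorname{Supp}(R)\subset\operatorname{Supp}(C_1+\cdots+C_{n-1})$, then $R$ is of type $A_{\lambda_1}\oplus\cdots\oplus A_{\lambda_r}$ for some $\lambda_1,\dots,\lambda_r\geq1$ satisfying $\sum_{i=1}^r\lambda_i+r-1\leq n-1$. (2) Assume $\operatorname{Supp}(R)\not\subset\operatorname{Supp}(C_1+\cdots+C_{n-1})$. Then, up to symmetry between the left and right ends, one of the following occurs. (a) $R$ contains leaves only at the left end. In this case $R=B_L+R_M$, where $B_L\in\{C_0',\,C_0'',\,C_0'+C_0''\}$ and $R_M$ is supported on mutually disjoint consecutive subchains of $C_1-C_2-\cdots-C_{n-1}$. If $R_M\neq0$ and $R_M$ is of type $A_{\lambda_1}\oplus\cdots\oplus A_{\lambda_r}$, then $\sum_{i=1}^r\lambda_i+r-1\leq n-1$. (b) $R$ contains leaves at both ends. In this case $R=B_L+R_M+B_R$, where $B_L\in\{C_0',\,C_0'',\,C_0'+C_0''\}$, $B_R\in\{C_n',\,C_n'',\,C_n'+C_n''\}$, and $R_M$ is supported on mutually disjoint consecutive subchains of $C_1-C_2-\cdots-C_{n-1}$. If $R_M\neq0$ and $R_M$ is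 of type $A_{\lambda_1}\oplus\cdots\oplus A_{\lambda_r}$, then $\sum_{i=1}^r\lambda_i+r-1\leq n-1$. Conversely, let $R_M$ be zero or a sum of mutually disjoint consecutive subchains of $C_1-C_2-\cdots-C_{n-1}$, of type $A_{\lambda_1}\oplus\cdots\oplus A_{\lambda_r}$ with $\sum_{i=1}^r\lambda_i+r-1\leq n-1$ if nonzero, and let $B_L\in\{C_0',\,C_0'',\,C_0'+C_0''\}$ and $B_R\in\{C_n',\,C_n'',\,C_n'+C_n''\}$. Then each of the reduced subdivisors $R_M$ (if nonzero), $B_L+R_M$, $R_M+B_R$ and $B_L+R_M+B_R$ of $F$ is an ADER.
   Context: We work over an algebraically closed field of characteristic $0$. In a fiber of type $I_n^*$ ($n\ge1$) all components are smooth rational $(-2)$-curves, meeting transversely in at most one point, with dual graph $\widetilde D_{n+4}$: $C_0-C_1-\cdots-C_n$ is a chain (the central chain), the leaves $C_0',C_0''$ (left end) are attached to $C_0$, and the leaves $C_n',C_n''$ (right end) are attached to $C_n$. The chain $C_1-\cdots-C_{n-1}$ is empty if $n=1$. An ADE reduced divisor (ADER) in $F$ is a nonzero reduced subdivisor of $F$ (a sum of distinct components) whose dual graph is a disjoint union of Dynkin diagrams of type $A_k$, $D_l$ ($l\ge4$), $E_6,E_7,E_8$; its type is the type of this graph, with $\oplus$ denoting disjoint union. "Mutually disjoint consecutive subchains" are the connected components of a set of vertices of the chain; two distinct ones are separated by at least one unused vertex. $R_M=0$ is allowed in (2). *)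

theory Defs
  imports Main "HOL-Library.Multiset"
begin

text \<open>
  The irreducible curves on the surface are the elements of a type \<open>'c\<close>, with intersection
  numbers \<open>isec :: 'c \<Rightarrow> 'c \<Rightarrow> int\<close>. An effective divisor is a multiset of irreducible curves:
  \<open>count D C\<close> is the multiplicity of \<open>C\<close> in \<open>D\<close>, \<open>set_mset D\<close> is the support, \<open>\<subseteq>#\<close> is the
  subdivisor relation.
\<close>

type_synonym 'c divisor = "'c multiset"

definition reduced :: "'c divisor \<Rightarrow> bool" where
  "reduced D \<longleftrightarrow> (\<forall>C. count D C \<le> 1)"

subsection \<open>Dual graphs and ADE types\<close>

definition components :: "('c \<Rightarrow> 'c \<Rightarrow> int) \<Rightarrow> 'c set \<Rightarrow> 'c set set" where
  "components isec S =
     (\<lambda>x. {y. (x, y) \<in> {(u, v). u \<in> S \<and> v \<in> S \<and> u \<noteq> v \<and> isec u v \<noteq> 0}\<^sup>*}) ` S"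

text \<open>
  The edges of a dual graph carry the intersection numbers as weights, so an isomorphism onto
  a simple graph requires every edge to be simple (intersection number 1).
\<close>

definition dual_graph_iso ::
    "('c \<Rightarrow> 'c \<Rightarrow> int) \<Rightarrow> 'c set \<Rightarrow> 'v set \<Rightarrow> 'v set set \<Rightarrow> bool" where
  "dual_graph_iso isec S V E \<longleftrightarrow>
     (\<exists>f. bij_betw f S V \<and>
          (\<forall>x\<in>S. \<forall>y\<in>S. x \<noteq> y \<longrightarrow> isec x y = (if {f x, f y} \<in> E then 1 else 0)))"

datatype ade = TypeA nat | TypeD nat | TypeE nat

fun valid_ade :: "ade \<Rightarrow> bool" where
  "valid_ade (TypeA k) \<longleftrightarrow> k \<ge> 1"
| "valid_ade (TypeD l) \<longleftrightarrow> l \<ge> 4"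
| "valid_ade (TypeE m) \<longleftrightarrow> m \<in> {6, 7, 8}"

text \<open>
  Vertices are numbered from 1 to the rank. In types D and E the last vertex is the one that
  is attached to the chain formed by all the other vertices.
\<close>

fun dynkin_vertices :: "ade \<Rightarrow> nat set" where
  "dynkin_vertices (TypeA k) = {1..k}"
| "dynkin_vertices (TypeD l) = {1..l}"
| "dynkin_vertices (TypeE m) = {1..m}"

fun dynkin_edges :: "ade \<Rightarrow> nat set set" where
  "dynkin_edges (TypeA k) = {{i, i + 1} |i. 1 \<le> i \<and> i < k}"
| "dynkin_edges (TypeD l) = {{i, i + 1} |i. 1 \<le> i \<and> i < l - 1} \<union> {{l - 2, l}}"
| "dynkin_edges (TypeE m) = {{i, i + 1} |i. 1 \<le> i \<and> i < m - 1} \<union> {{3, m}}"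

definition is_dynkin :: "('c \<Rightarrow> 'c \<Rightarrow> int) \<Rightarrow> 'c set \<Rightarrow> ade \<Rightarrow> bool" where
  "is_dynkin isec K t \<longleftrightarrow>
     valid_ade t \<and> dual_graph_iso isec K (dynkin_vertices t) (dynkin_edges t)"

text \<open>A type, i.e. a formal \<open>\<oplus>\<close>-sum of Dynkin types, is a multiset of Dynkin types.\<close>

definition has_type :: "('c \<Rightarrow> 'c \<Rightarrow> int) \<Rightarrow> 'c divisor \<Rightarrow> ade multiset \<Rightarrow> bool" where
  "has_type isec R T \<longleftrightarrow>
     (\<exists>\<tau>. (\<forall>K \<in> components isec (set_mset R). is_dynkin isec K (\<tau> K)) \<and>
          T = image_mset \<tau> (mset_set (components isec (set_mset R))))"

definition type_A_sum :: "nat list \<Rightarrow> ade multiset" where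
  "type_A_sum ls = image_mset TypeA (mset ls)"

definition ADER :: "('c \<Rightarrow> 'c \<Rightarrow> int) \<Rightarrow> 'c divisor \<Rightarrow> 'c divisor \<Rightarrow> bool" where
  "ADER isec F R \<longleftrightarrow>
     R \<noteq> {#} \<and> reduced R \<and> R \<subseteq># F \<and> (\<exists>T. has_type isec R T)"

subsection \<open>Fibers of type \<open>I\<^sub>n\<^sup>*\<close>\<close>

text \<open>
  Vertices of the extended Dynkin diagram \<open>D\<^sub>n\<^sub>+\<^sub>4\<close>: \<open>Chain i\<close> stands for the curve \<open>C\<^sub>i\<close>,
  and the leaves \<open>Left1\<close>, \<open>Left2\<close>, \<open>Right1\<close>, \<open>Right2\<close> for \<open>C\<^sub>0'\<close>, \<open>C\<^sub>0''\<close>, \<open>C\<^sub>n'\<close>, \<open>C\<^sub>n''\<close>.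
\<close>

datatype vertex = Chain nat | Left1 | Left2 | Right1 | Right2

definition ext_D_vertices :: "nat \<Rightarrow> vertex set" where
  "ext_D_vertices n = Chain ` {0..n} \<union> {Left1, Left2, Right1, Right2}"

definition ext_D_edges :: "nat \<Rightarrow> vertex set set" where
  "ext_D_edges n =
     {{Chain i, Chain (i + 1)} |i. i < n} \<union>
     {{Chain 0, Left1}, {Chain 0, Left2}, {Chain n, Right1}, {Chain n, Right2}}"

text \<open>
  \<open>F\<close> is a fiber of type \<open>I\<^sub>n\<^sup>*\<close> whose components are labelled by \<open>\<kappa>\<close>. The values of \<open>\<kappa>\<close>
  outside \<open>ext_D_vertices n\<close> are irrelevant.
  Only the numerical data of such a fiber are recorded (self-intersections \<open>-2\<close>, transverse
  intersections in at most one point, dual graph, multiplicities), not the ambient K3 surface.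
\<close>

definition I_star_fiber ::
    "('c \<Rightarrow> 'c \<Rightarrow> int) \<Rightarrow> nat \<Rightarrow> (vertex \<Rightarrow> 'c) \<Rightarrow> 'c divisor \<Rightarrow> bool" where
  "I_star_fiber isec n \<kappa> F \<longleftrightarrow>
     inj_on \<kappa> (ext_D_vertices n) \<and>
     (\<forall>u \<in> ext_D_vertices n. \<forall>v \<in> ext_D_vertices n.
        isec (\<kappa> u) (\<kappa> v) =
          (if u = v then - 2 else if {u, v} \<in> ext_D_edges n then 1 else 0)) \<and>
     F = {#\<kappa> Left1, \<kappa> Left2#} + (\<Sum>i\<in>{0..n}. {#\<kappa> (Chain i), \<kappa> (Chain i)#}) +
         {#\<kappa> Right1, \<kappa> Right2#}"

text \<open>The symmetry exchanging the left and the right end.\<close>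

fun flip :: "nat \<Rightarrow> vertex \<Rightarrow> vertex" where
  "flip n (Chain i) = Chain (n - i)"
| "flip n Left1 = Right1"
| "flip n Left2 = Right2"
| "flip n Right1 = Left1"
| "flip n Right2 = Left2"

definition inner_chain :: "nat \<Rightarrow> (vertex \<Rightarrow> 'c) \<Rightarrow> 'c set" where
  "inner_chain n \<kappa> = (\<lambda>i. \<kappa> (Chain i)) ` {1..<n}"

text \<open>
  A family of mutually disjoint consecutive subchains of \<open>C\<^sub>1 - \<dots> - C\<^sub>n\<^sub>-\<^sub>1\<close> is the family of
  connected components of a set of vertices of this chain; in particular two distinct members
  are separated by at least one unused vertex. The empty family is allowed.
\<close>

definition consecutive_subchains ::
    "('c \<Rightarrow> 'c \<Rightarrow> int) \<Rightarrow> nat \<Rightarrow> (vertex \<Rightarrow> 'c) \<Rightarrow> 'c set set \<Rightarrow> bool" where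
  "consecutive_subchains isec n \<kappa> \<K> \<longleftrightarrow>
     (\<forall>K\<in>\<K>. \<exists>a b. 1 \<le> a \<and> a \<le> b \<and> b < n \<and> K = (\<lambda>i. \<kappa> (Chain i)) ` {a..b}) \<and>
     \<K> = components isec (\<Union>\<K>)"

definition subchain_sum ::
    "('c \<Rightarrow> 'c \<Rightarrow> int) \<Rightarrow> nat \<Rightarrow> (vertex \<Rightarrow> 'c) \<Rightarrow> 'c divisor \<Rightarrow> bool" where
  "subchain_sum isec n \<kappa> M \<longleftrightarrow>
     (\<exists>\<K>. consecutive_subchains isec n \<kappa> \<K> \<and> M = (\<Sum>K\<in>\<K>. mset_set K))"

text \<open>\<open>\<lambda>\<^sub>1 + \<dots> + \<lambda>\<^sub>r + r - 1 \<le> n - 1\<close>, stated over the integers to avoid truncated subtraction.\<close>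

definition fits :: "nat \<Rightarrow> nat list \<Rightarrow> bool" where
  "fits n ls \<longleftrightarrow> int (sum_list ls) + int (length ls) - 1 \<le> int n - 1"

definition left_parts :: "(vertex \<Rightarrow> 'c) \<Rightarrow> 'c divisor set" where
  "left_parts \<kappa> = {{#\<kappa> Left1#}, {#\<kappa> Left2#}, {#\<kappa> Left1, \<kappa> Left2#}}"

definition right_parts :: "(vertex \<Rightarrow> 'c) \<Rightarrow> 'c divisor set" where
  "right_parts \<kappa> = {{#\<kappa> Right1#}, {#\<kappa> Right2#}, {#\<kappa> Right1, \<kappa> Right2#}}"

definition has_left_leaf :: "(vertex \<Rightarrow> 'c) \<Rightarrow> 'c divisor \<Rightarrow> bool" where
  "has_left_leaf \<kappa> R \<longleftrightarrow> \<kappa> Left1 \<in># R \<or> \<kappa> Left2 \<in># R"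

definition has_right_leaf :: "(vertex \<Rightarrow> 'c) \<Rightarrow> 'c divisor \<Rightarrow> bool" where
  "has_right_leaf \<kappa> R \<longleftrightarrow> \<kappa> Right1 \<in># R \<or> \<kappa> Right2 \<in># R"

definition leaves_left_only ::
    "('c \<Rightarrow> 'c \<Rightarrow> int) \<Rightarrow> nat \<Rightarrow> (vertex \<Rightarrow> 'c) \<Rightarrow> 'c divisor \<Rightarrow> bool" where
  "leaves_left_only isec n \<kappa> R \<longleftrightarrow>
     has_left_leaf \<kappa> R \<and> \<not> has_right_leaf \<kappa> R \<and>
     (\<exists>B\<^sub>L \<in> left_parts \<kappa>. \<exists>M.
        R = B\<^sub>L + M \<and> subchain_sum isec n \<kappa> M \<and>
        (M \<noteq> {#} \<longrightarrow> (\<forall>ls. has_type isec M (type_A_sum ls) \<longrightarrow> fits n ls)))"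

definition leaves_both_ends ::
    "('c \<Rightarrow> 'c \<Rightarrow> int) \<Rightarrow> nat \<Rightarrow> (vertex \<Rightarrow> 'c) \<Rightarrow> 'c divisor \<Rightarrow> bool" where
  "leaves_both_ends isec n \<kappa> R \<longleftrightarrow>
     has_left_leaf \<kappa> R \<and> has_right_leaf \<kappa> R \<and>
     (\<exists>B\<^sub>L \<in> left_parts \<kappa>. \<exists>B\<^sub>R \<in> right_parts \<kappa>. \<exists>M.
        R = B\<^sub>L + M + B\<^sub>R \<and> subchain_sum isec n \<kappa> M \<and>
        (M \<noteq> {#} \<longrightarrow> (\<forall>ls. has_type isec M (type_A_sum ls) \<longrightarrow> fits n ls)))"

end

theory Submission imports Defs "HOL-Library.Disjoint_Sets" begin

text \<open>
  Away from \<open>C\<^sub>0\<close> and \<open>C\<^sub>n\<close> the leaves are isolated vertices and the remaining graph is the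
  chain \<open>C\<^sub>1 - \<dots> - C\<^sub>n\<^sub>-\<^sub>1\<close>, so every component is a point or an interval of the chain. An
  interval is followed by an unused index in \<open>{2..n}\<close> (where \<open>n\<close> counts as unused), and these indices are distinct for
  distinct intervals: this gives the numerical bound.
\<close>

section \<open>Connected components\<close>

text \<open>Names the relation written out inside \<open>components\<close>, so that a component
  becomes the image of one curve under its reflexive transitive closure.\<close>

definition dual_edges :: "('c \<Rightarrow> 'c \<Rightarrow> int) \<Rightarrow> 'c set \<Rightarrow> ('c \<times> 'c) set" where
  "dual_edges isec S = {(u, v). u \<in> S \<and> v \<in> S \<and> u \<noteq> v \<and> isec u v \<noteq> 0}"

lemma components_alt: "components isec S = (\<lambda>x. (dual_edges isec S)\<^sup>* `` {x}) ` S"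
  by (auto simp: components_def dual_edges_def Image_def)

lemma component_subset:
  assumes "K \<in> components isec S"
  shows "K \<subseteq> S"
proof -
  obtain x where x: "x \<in> S" "K = (dual_edges isec S)\<^sup>* `` {x}"
    using assms by (auto simp: components_alt)
  have "y \<in> S" if "(x, y) \<in> (dual_edges isec S)\<^sup>*" for y
    using that x(1) by (induction rule: rtrancl_induct) (auto simp: dual_edges_def)
  then show ?thesis using x(2) by auto
qed

lemma component_nonempty: "K \<in> components isec S \<Longrightarrow> K \<noteq> {}"
  by (auto simp: components_alt)

lemma Union_components: "\<Union>(components isec S) = S"
proof
  show "\<Union>(components isec S) \<subseteq> S" using component_subset by blast
  show "S \<subseteq> \<Union>(components isec S)" by (auto simp: components_alt)
qed

lemma finite_components: "finite S \<Longrightarrow> finite (components isec S)"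
  by (simp add: components_alt)

lemma component_closed:
  assumes "K \<in> components isec S" "u \<in> K" "v \<in> S" "u \<noteq> v" "isec u v \<noteq> 0"
  shows "v \<in> K"
proof -
  obtain x where x: "K = (dual_edges isec S)\<^sup>* `` {x}"
    using assms(1) by (auto simp: components_alt)
  have "(u, v) \<in> dual_edges isec S"
    using assms component_subset[OF assms(1)] by (auto simp: dual_edges_def)
  then show ?thesis using assms(2) unfolding x by (auto intro: rtrancl_into_rtrancl)
qed

text \<open>Components are defined by forward reachability. Symmetry on \<open>S\<close> makes
  reachability an equivalence relation, and two classes sharing some \<open>z\<close>
  coincide.\<close>

lemma components_disjoint:
  assumes sym: "\<And>u v. u \<in> S \<Longrightarrow> v \<in> S \<Longrightarrow> isec u v = isec v u"
  shows "disjoint (components isec S)"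
proof -
  let ?A = "dual_edges isec S"
  have "sym ?A" using sym by (auto simp: dual_edges_def intro!: symI)
  then have s: "sym (?A\<^sup>*)" by (rule sym_rtrancl)
  have "?A\<^sup>* `` {x} = ?A\<^sup>* `` {y}" if "z \<in> ?A\<^sup>* `` {x}" "z \<in> ?A\<^sup>* `` {y}" for x y z
  proof -
    have "(x, y) \<in> ?A\<^sup>*" "(y, x) \<in> ?A\<^sup>*"
      using that s by (auto dest: symD intro: rtrancl_trans)
    then show ?thesis by (auto intro: rtrancl_trans)
  qed
  then show ?thesis unfolding disjoint_def components_alt by blast
qed

text \<open>Disjointness keeps every multiplicity at most 1. This identifies the sum in
  \<open>subchain_sum\<close> with the reduced divisor on the union.\<close>

lemma sum_mset_set_disjoint:
  assumes "finite \<K>" "\<forall>K\<in>\<K>. finite K" "disjoint \<K>"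
  shows "(\<Sum>K\<in>\<K>. mset_set K) = mset_set (\<Union>\<K>)"
  using assms
proof (induction \<K> rule: finite_induct)
  case (insert K \<K>)
  have "K \<inter> \<Union>\<K> = {}" using insert.hyps(2) insert.prems(2) by (auto simp: disjoint_def)
  moreover have "disjoint \<K>" using insert.prems(2) by (auto simp: disjoint_def)
  ultimately show ?case using insert by (simp add: mset_set_Union)
qed simp

section \<open>Sums of type A\<close>

lemma is_dynkin_card: "is_dynkin isec K t \<Longrightarrow> card K = card (dynkin_vertices t)"
  by (auto simp: is_dynkin_def dual_graph_iso_def bij_betw_same_card)

lemma is_dynkin_A_singleton: "is_dynkin isec {x} (TypeA 1)"
proof -
  have "bij_betw (\<lambda>_. 1) {x} {1..1::nat}" by (auto simp: bij_betw_def)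
  then show ?thesis unfolding is_dynkin_def dual_graph_iso_def by auto
qed

text \<open>The rank of a component of type A is its number of curves, so
  \<open>TypeA (card K)\<close> is a uniform choice for the labelling that \<open>has_type\<close>
  asks for. The list is any ordering of the multiset of these cardinalities.\<close>

lemma has_type_A_sum_exists:
  assumes "\<And>K. K \<in> components isec (set_mset R) \<Longrightarrow> \<exists>k. is_dynkin isec K (TypeA k)"
  shows "\<exists>ls. (\<forall>l\<in>set ls. l \<ge> 1) \<and> has_type isec R (type_A_sum ls)"
proof -
  let ?C = "components isec (set_mset R)"
  have dyn: "is_dynkin isec K (TypeA (card K)) \<and> card K \<ge> 1" if K: "K \<in> ?C" for K
  proof -
    obtain k where k: "is_dynkin isec K (TypeA k)" using assms[OF K] by blast
    then have "card K = k" using is_dynkin_card by fastforce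
    with k show ?thesis by (auto simp: is_dynkin_def)
  qed
  obtain ls where ls: "mset ls = image_mset card (mset_set ?C)"
    using ex_mset by blast
  have "set ls = card ` ?C"
    using arg_cong[OF ls, of set_mset] finite_components[of "set_mset R" isec] by simp
  then have "\<forall>l\<in>set ls. l \<ge> 1" using dyn by auto
  moreover have "has_type isec R (type_A_sum ls)"
    unfolding has_type_def type_A_sum_def ls
    using dyn by (intro exI[of _ "\<lambda>K. TypeA (card K)"]) (auto simp: multiset.map_comp o_def)
  ultimately show ?thesis by blast
qed

text \<open>Counting vertices on both sides of the equation of types eliminates the unknown
  labelling \<tau>. Hence the list is determined up to order, and a bound proved from the graph
  holds for every list describing the type.\<close>

lemma has_type_A_sum_cards:
  assumes "has_type isec R (type_A_sum ls)"
  shows "mset ls = image_mset card (mset_set (components isec (set_mset R)))"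
proof -
  let ?C = "components isec (set_mset R)"
  obtain \<tau> where \<tau>: "\<forall>K\<in>?C. is_dynkin isec K (\<tau> K)"
    and eq: "image_mset TypeA (mset ls) = image_mset \<tau> (mset_set ?C)"
    using assms by (auto simp: has_type_def type_A_sum_def)
  have "mset ls = image_mset (\<lambda>t. card (dynkin_vertices t)) (image_mset TypeA (mset ls))"
    by (simp add: multiset.map_comp o_def)
  also have "\<dots> = image_mset (\<lambda>K. card (dynkin_vertices (\<tau> K))) (mset_set ?C)"
    unfolding eq by (simp add: multiset.map_comp o_def)
  also have "\<dots> = image_mset card (mset_set ?C)"
    using \<tau> finite_components[of "set_mset R" isec]
    by (intro image_mset_cong) (auto dest!: bspec is_dynkin_card)
  finally show ?thesis .
qed

section \<open>The fiber without its two nodes\<close>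

definition leaves :: "vertex set" where
  "leaves = {Left1, Left2, Right1, Right2}"

definition off_nodes :: "nat \<Rightarrow> vertex set" where
  "off_nodes n = leaves \<union> Chain ` {1..<n}"

lemma off_nodes_subset: "off_nodes n \<subseteq> ext_D_vertices n"
  by (auto simp: off_nodes_def leaves_def ext_D_vertices_def)

lemma reduced_mset_set: "reduced R \<Longrightarrow> R = mset_set (set_mset R)"
  by (rule multiset_eqI)
    (metis count_greater_eq_one_iff count_mset_set(1,3) finite_set_mset le_antisym not_in_iff reduced_def)

text \<open>The reflection i -> n - i maps the inner chain to itself and intervals to intervals. The
  condition on components speaks of curves rather than labels, so it carries over unchanged.\<close>

lemma subchain_sum_flip:
  assumes "subchain_sum isec n \<kappa> M"
  shows "subchain_sum isec n (\<kappa> \<circ> flip n) M"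
proof -
  have reflect: "\<exists>a' b'. 1 \<le> a' \<and> a' \<le> b' \<and> b' < n \<and>
      (\<lambda>i. \<kappa> (Chain i)) ` {a..b} = (\<lambda>i. (\<kappa> \<circ> flip n) (Chain i)) ` {a'..b'}"
    if ab: "1 \<le> a" "a \<le> b" "b < n" for a b
  proof -
    have "{a..b} = (\<lambda>i. n - i) ` {n - b..n - a}"
    proof
      show "{a..b} \<subseteq> (\<lambda>i. n - i) ` {n - b..n - a}"
      proof
        fix i assume "i \<in> {a..b}"
        \<comment> \<open>Truncated subtraction is involutive here because i <= b < n.\<close>
        with ab show "i \<in> (\<lambda>i. n - i) ` {n - b..n - a}" by (intro image_eqI[of _ _ "n - i"]) auto
      qed
    qed (use ab in auto)
    then have "(\<lambda>i. \<kappa> (Chain i)) ` {a..b} = (\<lambda>i. (\<kappa> \<circ> flip n) (Chain i)) ` {n - b..n - a}"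
      by (simp add: image_image)
    with ab show ?thesis by (intro exI[of _ "n - b"] exI[of _ "n - a"]) auto
  qed
  obtain \<K> where \<K>: "consecutive_subchains isec n \<kappa> \<K>" and M: "M = (\<Sum>K\<in>\<K>. mset_set K)"
    using assms unfolding subchain_sum_def by blast
  have "\<forall>K\<in>\<K>. \<exists>a b. 1 \<le> a \<and> a \<le> b \<and> b < n \<and> K = (\<lambda>i. \<kappa> (Chain i)) ` {a..b}"
    using \<K> unfolding consecutive_subchains_def by (rule conjunct1)
  then have "\<forall>K\<in>\<K>. \<exists>a b. 1 \<le> a \<and> a \<le> b \<and> b < n \<and>
      K = (\<lambda>i. (\<kappa> \<circ> flip n) (Chain i)) ` {a..b}"
    using reflect by fast
  moreover have "\<K> = components isec (\<Union>\<K>)"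
    using \<K> unfolding consecutive_subchains_def by (rule conjunct2)
  ultimately have "consecutive_subchains isec n (\<kappa> \<circ> flip n) \<K>"
    unfolding consecutive_subchains_def by (rule conjI)
  with M show ?thesis unfolding subchain_sum_def by blast
qed

context
  fixes isec :: "'c \<Rightarrow> 'c \<Rightarrow> int" and n :: nat and \<kappa> :: "vertex \<Rightarrow> 'c" and F :: "'c divisor"
  assumes fiber: "I_star_fiber isec n \<kappa> F"
begin

section \<open>Labels and intersection numbers away from the nodes\<close>

lemma label_inj: "inj_on \<kappa> (ext_D_vertices n)"
  using fiber by (simp add: I_star_fiber_def)

lemma label_eq_iff:
  "u \<in> off_nodes n \<Longrightarrow> v \<in> off_nodes n \<Longrightarrow> \<kappa> u = \<kappa> v \<longleftrightarrow> u = v"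
  using inj_on_eq_iff[OF label_inj] off_nodes_subset by blast

lemma isec_label:
  "u \<in> off_nodes n \<Longrightarrow> v \<in> off_nodes n \<Longrightarrow>
    isec (\<kappa> u) (\<kappa> v) = (if u = v then - 2 else if {u, v} \<in> ext_D_edges n then 1 else 0)"
  using fiber off_nodes_subset unfolding I_star_fiber_def by blast

text \<open>Symmetry is not a hypothesis on \<open>isec\<close>; on the fiber it follows because
  edges are unordered pairs.\<close>

lemma isec_sym:
  assumes "S \<subseteq> \<kappa> ` off_nodes n" "u \<in> S" "v \<in> S"
  shows "isec u v = isec v u"
proof -
  obtain x y where "x \<in> off_nodes n" "y \<in> off_nodes n" "u = \<kappa> x" "v = \<kappa> y"
    using assms by blast
  then show ?thesis by (simp add: isec_label insert_commute)
qed

lemma isec_chain: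
  assumes "i \<in> {1..<n}" "j \<in> {1..<n}" "i \<noteq> j"
  shows "isec (\<kappa> (Chain i)) (\<kappa> (Chain j)) = (if j = i + 1 \<or> i = j + 1 then 1 else 0)"
proof -
  have "{Chain i, Chain j} \<in> ext_D_edges n \<longleftrightarrow> j = i + 1 \<or> i = j + 1"
    using assms unfolding ext_D_edges_def by (auto simp: doubleton_eq_iff)
  with assms show ?thesis by (subst isec_label) (auto simp: off_nodes_def)
qed

text \<open>Every edge at a leaf ends in \<open>Chain 0\<close> or \<open>Chain n\<close>, and
  neither lies in \<open>off_nodes n\<close>.\<close>

lemma isec_leaf:
  assumes "l \<in> leaves" "v \<in> off_nodes n" "v \<noteq> l"
  shows "isec (\<kappa> l) (\<kappa> v) = 0" "isec (\<kappa> v) (\<kappa> l) = 0"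
proof -
  have "{l, v} \<notin> ext_D_edges n"
    using assms by (auto simp: ext_D_edges_def off_nodes_def leaves_def doubleton_eq_iff)
  then have "{v, l} \<notin> ext_D_edges n" by (simp only: insert_commute not_False_eq_True)
  moreover have "l \<in> off_nodes n" using assms(1) by (simp add: off_nodes_def)
  ultimately show "isec (\<kappa> l) (\<kappa> v) = 0" "isec (\<kappa> v) (\<kappa> l) = 0"
    using \<open>{l, v} \<notin> ext_D_edges n\<close> assms(2,3) by (simp_all add: isec_label)
qed

section \<open>Shape and type of the components\<close>

lemma leaf_component:
  assumes S: "S \<subseteq> \<kappa> ` off_nodes n" and l: "l \<in> leaves"
  shows "(dual_edges isec S)\<^sup>* `` {\<kappa> l} = {\<kappa> l}"
proof -
  have "y = \<kappa> l" if "(\<kappa> l, y) \<in> (dual_edges isec S)\<^sup>*" for y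
    using that
  proof (induction rule: rtrancl_induct)
    case (step y z)
    have z: "z \<in> S" "isec (\<kappa> l) z \<noteq> 0" "\<kappa> l \<noteq> z"
      using step by (auto simp: dual_edges_def)
    then obtain v where "v \<in> off_nodes n" "z = \<kappa> v" using S by blast
    with z isec_leaf(1)[OF l, of v] show ?case by auto
  qed simp
  then show ?thesis by auto
qed

lemma chain_path:
  assumes "i \<le> j" "{i..j} \<subseteq> {k \<in> {1..<n}. \<kappa> (Chain k) \<in> S}"
  shows "(\<kappa> (Chain i), \<kappa> (Chain j)) \<in> (dual_edges isec S)\<^sup>*"
  using assms
proof (induction j rule: dec_induct)
  case (step k)
  have "(\<kappa> (Chain i), \<kappa> (Chain k)) \<in> (dual_edges isec S)\<^sup>*"
    by (intro step.IH order_trans[OF _ step.prems]) auto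
  moreover have "{k, Suc k} \<subseteq> {k \<in> {1..<n}. \<kappa> (Chain k) \<in> S}"
    using step.hyps(1) by (intro order_trans[OF _ step.prems]) auto
  then have "(\<kappa> (Chain k), \<kappa> (Chain (Suc k))) \<in> dual_edges isec S"
    using isec_chain[of k "Suc k"] label_eq_iff[of "Chain k" "Chain (Suc k)"]
    by (auto simp: dual_edges_def off_nodes_def)
  ultimately show ?case by (rule rtrancl_into_rtrancl)
qed simp

text \<open>Paths from \<open>Chain i\<close> stay in the set \<open>J\<close> of indices joined to
  \<open>i\<close> by a segment of used indices, and \<open>chain_path\<close> reaches all of
  \<open>J\<close>. A finite set of this kind is the interval from its minimum to its
  maximum.\<close>

lemma chain_component:
  assumes S: "S \<subseteq> \<kappa> ` off_nodes n" and i: "i \<in> {1..<n}" "\<kappa> (Chain i) \<in> S"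
  shows "\<exists>a b. 1 \<le> a \<and> a \<le> b \<and> b < n \<and>
    (dual_edges isec S)\<^sup>* `` {\<kappa> (Chain i)} = (\<lambda>j. \<kappa> (Chain j)) ` {a..b}"
proof -
  let ?A = "dual_edges isec S"
  define I where "I = {k \<in> {1..<n}. \<kappa> (Chain k) \<in> S}"
  \<comment> \<open>The use of \<open>min\<close> and \<open>max\<close> treats indices on both
    sides of \<open>i\<close> at once.\<close>
  define J where "J = {j. {min i j..max i j} \<subseteq> I}"
  have iJ: "i \<in> J" using i by (auto simp: J_def I_def)
  have JI: "J \<subseteq> I" by (auto simp: J_def)
  have finJ: "finite J" by (rule finite_subset[OF JI]) (simp add: I_def)
  have "y \<in> (\<lambda>j. \<kappa> (Chain j)) ` J" if "(\<kappa> (Chain i), y) \<in> ?A\<^sup>*" for y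
    using that
  proof (induction rule: rtrancl_induct)
    case base
    then show ?case using iJ by blast
  next
    case (step y z)
    obtain j where j: "j \<in> J" "y = \<kappa> (Chain j)" using step.IH by blast
    have jn: "j \<in> {1..<n}" using j JI by (auto simp: I_def)
    have z: "z \<in> S" "y \<noteq> z" "isec y z \<noteq> 0" using step.hyps(2) by (auto simp: dual_edges_def)
    obtain v where v: "v \<in> off_nodes n" "z = \<kappa> v" using z(1) S by blast
    have "v \<notin> leaves" using isec_leaf(2)[of v "Chain j"] z j v jn by (auto simp: off_nodes_def)
    then obtain k where k: "v = Chain k" "k \<in> {1..<n}" using v by (auto simp: off_nodes_def)
    have "j \<noteq> k" using z(2) j(2) v(2) k(1) by auto
    then have "k = j + 1 \<or> j = k + 1"
      using isec_chain[OF jn k(2)] z j v k by (auto split: if_splits)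
    moreover have "k \<in> I" using k v z by (simp add: I_def)
    \<comment> \<open>A step away from \<open>i\<close> adds only \<open>k\<close> to the segment; a
      step towards \<open>i\<close> shortens it.\<close>
    ultimately have "{min i k..max i k} \<subseteq> insert k {min i j..max i j}" by auto
    with \<open>k \<in> I\<close> j(1) have "k \<in> J" by (auto simp: J_def)
    then show ?case using v k by blast
  qed
  moreover have "(\<kappa> (Chain i), \<kappa> (Chain j)) \<in> ?A\<^sup>*" if j: "j \<in> J" for j
  proof (cases "i \<le> j")
    case True
    then show ?thesis using j by (intro chain_path) (auto simp: J_def I_def)
  next
    case False
    \<comment> \<open>\<open>chain_path\<close> only ascends, so an index below \<open>i\<close> is
      reached by reversing a path.\<close>
    then have "(\<kappa> (Chain j), \<kappa> (Chain i)) \<in> ?A\<^sup>*"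
      using j by (intro chain_path) (auto simp: J_def I_def)
    moreover have "sym ?A" using isec_sym[OF S] by (auto simp: dual_edges_def intro!: symI)
    ultimately show ?thesis by (metis sym_rtrancl symD)
  qed
  ultimately have "?A\<^sup>* `` {\<kappa> (Chain i)} = (\<lambda>j. \<kappa> (Chain j)) ` J" by auto
  moreover have "J = {Min J..Max J}"
  proof
    show "J \<subseteq> {Min J..Max J}" using finJ by auto
    have m: "Min J \<in> J" "Max J \<in> J" using finJ iJ by (auto intro: Min_in Max_in)
    show "{Min J..Max J} \<subseteq> J"
    proof
      fix k assume "k \<in> {Min J..Max J}"
      \<comment> \<open>Convexity: the segment from \<open>i\<close> to \<open>k\<close> lies in the
        segment from \<open>i\<close> to the end of \<open>J\<close> on the same side.\<close>
      then have "{min i k..max i k} \<subseteq> {min i (Min J)..max i (Min J)} \<union> {min i (Max J)..max i (Max J)}"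
        by auto
      with m show "k \<in> J" by (auto simp: J_def)
    qed
  qed
  moreover have "Min J \<in> I" "Max J \<in> I" "Min J \<le> Max J"
    using finJ iJ JI Min_in[of J] Max_in[of J] Min_le[of J i] Max_ge[of J i] by fastforce+
  ultimately show ?thesis unfolding I_def
    by (intro exI[of _ "Min J"] exI[of _ "Max J"]) auto
qed

lemma is_dynkin_interval:
  assumes "1 \<le> a" "a \<le> b" "b < n"
  shows "is_dynkin isec ((\<lambda>j. \<kappa> (Chain j)) ` {a..b}) (TypeA (b + 1 - a))"
proof -
  let ?c = "\<lambda>j. \<kappa> (Chain j)"
  have inj: "inj_on ?c {a..b}"
    using assms label_eq_iff by (fastforce simp: inj_on_def off_nodes_def)
  \<comment> \<open>The index of the curve, shifted so that \<open>a\<close> receives the Dynkin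
    number 1.\<close>
  define f where "f x = the_inv_into {a..b} ?c x + 1 - a" for x
  have f: "f (?c j) = j + 1 - a" if "j \<in> {a..b}" for j
    using the_inv_into_f_f[OF inj that] by (simp add: f_def)
  have "bij_betw f (?c ` {a..b}) {1..b + 1 - a}"
    unfolding bij_betw_def
  proof
    show "inj_on f (?c ` {a..b})"
    proof (rule inj_onI)
      fix x y assume "x \<in> ?c ` {a..b}" "y \<in> ?c ` {a..b}" "f x = f y"
      then obtain i j where "x = ?c i" "y = ?c j" "i \<in> {a..b}" "j \<in> {a..b}" "f (?c i) = f (?c j)"
        by blast
      then have "i = j" using f[of i] f[of j] by auto
      then show "x = y" using \<open>x = ?c i\<close> \<open>y = ?c j\<close> by simp
    qed
    have "k \<in> f ` ?c ` {a..b}" if "k \<in> {1..b + 1 - a}" for k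
    proof (rule image_eqI)
      have "k + a - 1 \<in> {a..b}" using that assms by auto
      then show "?c (k + a - 1) \<in> ?c ` {a..b}" by blast
      show "k = f (?c (k + a - 1))"
        using f[OF \<open>k + a - 1 \<in> {a..b}\<close>] that by simp
    qed
    then show "f ` ?c ` {a..b} = {1..b + 1 - a}" using f assms by auto
  qed
  moreover have "isec x y = (if {f x, f y} \<in> dynkin_edges (TypeA (b + 1 - a)) then 1 else 0)"
    if xy: "x \<in> ?c ` {a..b}" "y \<in> ?c ` {a..b}" "x \<noteq> y" for x y
  proof -
    obtain i j where ij: "x = ?c i" "y = ?c j" "i \<in> {a..b}" "j \<in> {a..b}" "i \<noteq> j"
      using xy by blast
    have "{f x, f y} \<in> dynkin_edges (TypeA (b + 1 - a)) \<longleftrightarrow> j = i + 1 \<or> i = j + 1"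
    proof
      assume "{f x, f y} \<in> dynkin_edges (TypeA (b + 1 - a))"
      then show "j = i + 1 \<or> i = j + 1"
        using ij(3-5) unfolding ij(1,2) f[OF ij(3)] f[OF ij(4)] by (auto simp: doubleton_eq_iff)
    next
      assume "j = i + 1 \<or> i = j + 1"
      \<comment> \<open>\<open>l\<close> is the Dynkin number of whichever curve has the smaller
        index.\<close>
      then have "{f x, f y} = {l, l + 1} \<and> 1 \<le> l \<and> l < b + 1 - a" if "l = min i j + 1 - a" for l
        using ij(3-5) that unfolding ij(1,2) f[OF ij(3)] f[OF ij(4)] by auto
      then show "{f x, f y} \<in> dynkin_edges (TypeA (b + 1 - a))" by auto
    qed
    then show ?thesis using isec_chain[of i j] ij assms by auto
  qed
  ultimately show ?thesis using assms unfolding is_dynkin_def dual_graph_iso_def by auto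
qed

text \<open>A component is generated by any chosen representative, so whether that vertex is a leaf
  decides its shape.\<close>

lemma component_cases:
  assumes S: "S \<subseteq> \<kappa> ` off_nodes n" and K: "K \<in> components isec S"
  obtains (leaf) l where "l \<in> leaves" "K = {\<kappa> l}"
    | (interval) a b where "1 \<le> a" "a \<le> b" "b < n" "K = (\<lambda>j. \<kappa> (Chain j)) ` {a..b}"
proof -
  obtain v where v: "v \<in> off_nodes n" "\<kappa> v \<in> S" "K = (dual_edges isec S)\<^sup>* `` {\<kappa> v}"
    using S K by (auto simp: components_alt)
  show thesis
  proof (cases "v \<in> leaves")
    case True
    then show ?thesis using leaf_component[OF S True] v leaf by simp
  next
    case False
    then obtain i where "v = Chain i" "i \<in> {1..<n}" using v(1) by (auto simp: off_nodes_def)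
    then show ?thesis using chain_component[OF S, of i] v interval by auto
  qed
qed

lemma component_type_A:
  assumes "S \<subseteq> \<kappa> ` off_nodes n" "K \<in> components isec S"
  shows "\<exists>k. is_dynkin isec K (TypeA k)"
  using component_cases[OF assms] is_dynkin_A_singleton is_dynkin_interval by metis

section \<open>Subchain sums as reduced divisors on the inner chain\<close>

lemma inner_chain_subset: "inner_chain n \<kappa> \<subseteq> \<kappa> ` off_nodes n"
  by (auto simp: inner_chain_def off_nodes_def)

text \<open>The components of \<open>S\<close> themselves form the required family. Together with
  \<open>subchain_sum_cases\<close> this shows that subchain sums are exactly the reduced divisors
  supported on the inner chain.\<close>

lemma subchain_sum_mset_set:
  assumes S: "S \<subseteq> inner_chain n \<kappa>"
  shows "subchain_sum isec n \<kappa> (mset_set S)"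
proof -
  let ?C = "components isec S"
  have S': "S \<subseteq> \<kappa> ` off_nodes n" using S inner_chain_subset by blast
  have fin: "finite S" by (rule finite_subset[OF S]) (simp add: inner_chain_def)
  have "\<exists>a b. 1 \<le> a \<and> a \<le> b \<and> b < n \<and> K = (\<lambda>i. \<kappa> (Chain i)) ` {a..b}" if K: "K \<in> ?C" for K
  proof -
    obtain x where x: "x \<in> S" "K = (dual_edges isec S)\<^sup>* `` {x}"
      using K by (auto simp: components_alt)
    moreover obtain i where "i \<in> {1..<n}" "x = \<kappa> (Chain i)"
      using x(1) S by (auto simp: inner_chain_def)
    ultimately show ?thesis using chain_component[OF S', of i] by simp
  qed
  moreover have "(\<Sum>K\<in>?C. mset_set K) = mset_set (\<Union>?C)"
    by (intro sum_mset_set_disjoint finite_components components_disjoint isec_sym[OF S'] fin ballI)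
      (blast intro: finite_subset[OF component_subset fin])
  ultimately show ?thesis
    unfolding subchain_sum_def consecutive_subchains_def
    by (intro exI[of _ ?C]) (simp add: Union_components)
qed

text \<open>Being the components of its own union makes the family disjoint, so no curve is counted
  twice in the sum.\<close>

lemma subchain_sum_cases:
  assumes "subchain_sum isec n \<kappa> M"
  obtains S where "S \<subseteq> inner_chain n \<kappa>" "M = mset_set S"
proof -
  obtain \<K> where \<K>: "\<forall>K\<in>\<K>. \<exists>a b. 1 \<le> a \<and> a \<le> b \<and> b < n \<and> K = (\<lambda>i. \<kappa> (Chain i)) ` {a..b}"
    and comp: "\<K> = components isec (\<Union>\<K>)" and M: "M = (\<Sum>K\<in>\<K>. mset_set K)"
    using assms unfolding subchain_sum_def consecutive_subchains_def by blast
  have sub: "\<Union>\<K> \<subseteq> inner_chain n \<kappa>"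
    using \<K> unfolding inner_chain_def by fastforce
  then have fin: "finite (\<Union>\<K>)" by (rule finite_subset) (simp add: inner_chain_def)
  have "disjoint (components isec (\<Union>\<K>))"
    by (rule components_disjoint) (rule isec_sym[OF order_trans[OF sub inner_chain_subset]])
  then have "disjoint \<K>" by (simp only: comp[symmetric])
  moreover have "finite \<K>" using fin by (rule finite_UnionD)
  moreover have "\<forall>K\<in>\<K>. finite K" using \<K> by auto
  ultimately have "M = mset_set (\<Union>\<K>)" unfolding M by (intro sum_mset_set_disjoint)
  with sub show thesis by (rule that)
qed

section \<open>The numerical bound\<close>

lemma card_components_inner_chain:
  assumes S: "S \<subseteq> inner_chain n \<kappa>"
  shows "card S + card (components isec S) \<le> n"
proof -
  define I where "I = {k \<in> {1..<n}. \<kappa> (Chain k) \<in> S}"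
  define E where "E = {i \<in> I. Suc i \<notin> I}"
  have SI: "S = (\<lambda>j. \<kappa> (Chain j)) ` I" using S by (auto simp: I_def inner_chain_def)
  have S': "S \<subseteq> \<kappa> ` off_nodes n" using S inner_chain_subset by blast
  have finI: "finite I" by (simp add: I_def)
  then have finE: "finite E" by (simp add: E_def)
  have "components isec S \<subseteq> (\<lambda>i. (dual_edges isec S)\<^sup>* `` {\<kappa> (Chain i)}) ` E"
  proof
    fix K assume K: "K \<in> components isec S"
    define J where "J = {j \<in> I. \<kappa> (Chain j) \<in> K}"
    have "finite J" using finI by (simp add: J_def)
    moreover have "J \<noteq> {}"
      using component_nonempty[OF K] component_subset[OF K] SI by (auto simp: J_def)
    ultimately have "Max J \<in> J" by (rule Max_in)
    then have m: "Max J \<in> I" "\<kappa> (Chain (Max J)) \<in> K" by (auto simp: J_def)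
    have "Suc (Max J) \<notin> I"
    proof
      assume s: "Suc (Max J) \<in> I"
      \<comment> \<open>The next curve meets the last curve of \<open>K\<close>, and a component
        contains every curve of \<open>S\<close> that meets it.\<close>
      have "\<kappa> (Chain (Suc (Max J))) \<in> K"
        using m s isec_chain[of "Max J" "Suc (Max J)"]
          label_eq_iff[of "Chain (Max J)" "Chain (Suc (Max J))"]
        by (intro component_closed[OF K m(2)]) (auto simp: I_def off_nodes_def)
      with s have "Suc (Max J) \<in> J" by (simp add: J_def)
      then have "Suc (Max J) \<le> Max J" using \<open>finite J\<close> by (rule Max_ge[rotated])
      then show False by simp
    qed
    with m have "Max J \<in> E" by (simp add: E_def)
    moreover have "K = (dual_edges isec S)\<^sup>* `` {\<kappa> (Chain (Max J))}" (is "K = ?K")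
    proof (rule ccontr)
      assume "K \<noteq> ?K"
      \<comment> \<open>Both sets are components containing the curve of index \<open>Max J\<close>,
        so disjointness forces equality.\<close>
      moreover have "?K \<in> components isec S" using m(1) by (auto simp: components_alt I_def)
      ultimately have "K \<inter> ?K = {}"
        using disjointD[OF components_disjoint[OF isec_sym[OF S']] K] by blast
      with m(2) show False by blast
    qed
    ultimately show "K \<in> (\<lambda>i. (dual_edges isec S)\<^sup>* `` {\<kappa> (Chain i)}) ` E" by blast
  qed
  then have "card (components isec S) \<le> card E" using finE by (rule surj_card_le[rotated])
  also have "card E = card (Suc ` E)" by (simp add: card_image)
  finally have "card S + card (components isec S) \<le> card I + card (Suc ` E)"
    unfolding SI using card_image_le[OF finI, of "\<lambda>j. \<kappa> (Chain j)"] by linarith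
  also have "\<dots> = card (I \<union> Suc ` E)"
    using finI finE by (intro card_Un_disjoint[symmetric]) (auto simp: E_def)
  \<comment> \<open>The value n has to be allowed: it is the successor when n - 1 belongs to
    \<open>E\<close>.\<close>
  also have "\<dots> \<le> card {1..n}" by (intro card_mono) (auto simp: E_def I_def)
  finally show ?thesis by simp
qed

text \<open>The length of the list counts components and its sum counts curves, so
  \<open>fits\<close> is the preceding bound with 1 subtracted on both sides.\<close>

lemma has_type_A_sum_fits:
  assumes S: "set_mset M \<subseteq> inner_chain n \<kappa>" and t: "has_type isec M (type_A_sum ls)"
  shows "fits n ls"
proof -
  let ?C = "components isec (set_mset M)"
  note ms = has_type_A_sum_cards[OF t]
  have S': "set_mset M \<subseteq> \<kappa> ` off_nodes n" using S inner_chain_subset by blast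
  have "length ls = card ?C" using arg_cong[OF ms, of size] by simp
  moreover have "sum_list ls = (\<Sum>K\<in>?C. card K)"
    using arg_cong[OF ms, of sum_mset] by (simp add: sum_mset_sum_list sum_unfold_sum_mset)
  moreover have "(\<Sum>K\<in>?C. card K) = card (\<Union>?C)"
    by (intro card_Union_disjoint[symmetric] components_disjoint isec_sym[OF S'])
      (auto intro: finite_subset[OF component_subset])
  ultimately show ?thesis
    using card_components_inner_chain[OF S] unfolding fits_def Union_components by linarith
qed

section \<open>Reduced subdivisors of the fiber that avoid the nodes\<close>

lemma fiber_support: "set_mset F = \<kappa> ` ext_D_vertices n"
proof -
  have "F = {#\<kappa> Left1, \<kappa> Left2#} + (\<Sum>i\<in>{0..n}. {#\<kappa> (Chain i), \<kappa> (Chain i)#}) +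
         {#\<kappa> Right1, \<kappa> Right2#}"
    using fiber by (simp add: I_star_fiber_def)
  then show ?thesis
    by (auto simp: set_mset_sum ext_D_vertices_def)
qed

text \<open>Every curve of the support occurs in \<open>F\<close> at least once, which suffices for
  a reduced divisor to be a subdivisor. A type exists because all components have type A.\<close>

lemma ADER_mset_set:
  assumes S: "S \<subseteq> \<kappa> ` off_nodes n" "S \<noteq> {}"
  shows "ADER isec F (mset_set S)"
proof -
  have fin: "finite S" by (rule finite_subset[OF S(1)]) (simp add: off_nodes_def leaves_def)
  have "mset_set S \<subseteq># F"
  proof (rule mset_subset_eqI)
    fix x
    show "count (mset_set S) x \<le> count F x"
    proof (cases "x \<in> S")
      case True
      then have "x \<in># F" using S(1) off_nodes_subset fiber_support by blast
      with True fin show ?thesis by simp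
    qed simp
  qed
  moreover have "reduced (mset_set S)" unfolding reduced_def by (simp add: count_mset_set')
  moreover have "\<exists>T. has_type isec (mset_set S) T"
    using has_type_A_sum_exists[of isec "mset_set S"] component_type_A[OF S(1)] fin by auto
  ultimately show ?thesis using S(2) fin by (simp add: ADER_def mset_set_empty_iff)
qed

text \<open>Reduces the classification to a statement about the support, a set of labelled curves
  without nodes.\<close>

lemma ADER_off_nodes:
  assumes "ADER isec F R" "\<kappa> (Chain 0) \<notin># R" "\<kappa> (Chain n) \<notin># R"
  shows "set_mset R \<subseteq> \<kappa> ` off_nodes n" "R = mset_set (set_mset R)"
proof -
  have "ext_D_vertices n \<subseteq> insert (Chain 0) (insert (Chain n) (off_nodes n))"
    by (fastforce simp: ext_D_vertices_def off_nodes_def leaves_def)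
  moreover have "set_mset R \<subseteq> \<kappa> ` ext_D_vertices n"
    using assms(1) fiber_support by (auto simp: ADER_def dest: mset_subset_eqD)
  ultimately show "set_mset R \<subseteq> \<kappa> ` off_nodes n" using assms(2,3) by blast
  show "R = mset_set (set_mset R)" using assms(1) unfolding ADER_def by (intro reduced_mset_set) simp
qed

section \<open>Splitting into left leaves, inner chain and right leaves\<close>

text \<open>Replaces the three listed divisors by nonempty sets of leaves, so that the choice of a
  part becomes an intersection with the support. Distinctness of the two labels makes the two-leaf
  divisor reduced.\<close>

lemma left_parts_eq: "left_parts \<kappa> = mset_set ` (Pow {\<kappa> Left1, \<kappa> Left2} - {{}})"
proof -
  have "\<kappa> Left1 \<noteq> \<kappa> Left2" by (simp add: label_eq_iff off_nodes_def leaves_def)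
  moreover have "Pow {\<kappa> Left1, \<kappa> Left2} - {{}} = {{\<kappa> Left1}, {\<kappa> Left2}, {\<kappa> Left1, \<kappa> Left2}}"
    by auto
  ultimately show ?thesis by (simp add: left_parts_def)
qed

lemma right_parts_eq: "right_parts \<kappa> = mset_set ` (Pow {\<kappa> Right1, \<kappa> Right2} - {{}})"
proof -
  have "\<kappa> Right1 \<noteq> \<kappa> Right2" by (simp add: label_eq_iff off_nodes_def leaves_def)
  moreover have "Pow {\<kappa> Right1, \<kappa> Right2} - {{}} =
      {{\<kappa> Right1}, {\<kappa> Right2}, {\<kappa> Right1, \<kappa> Right2}}"
    by auto
  ultimately show ?thesis by (simp add: right_parts_def)
qed

lemma leaves_inner_disjoint:
  "{\<kappa> Left1, \<kappa> Left2} \<inter> inner_chain n \<kappa> = {}"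
  "{\<kappa> Right1, \<kappa> Right2} \<inter> inner_chain n \<kappa> = {}"
  "{\<kappa> Left1, \<kappa> Left2} \<inter> {\<kappa> Right1, \<kappa> Right2} = {}"
  using label_eq_iff by (auto simp: inner_chain_def off_nodes_def leaves_def)

lemma off_nodes_image:
  "\<kappa> ` off_nodes n = {\<kappa> Left1, \<kappa> Left2} \<union> inner_chain n \<kappa> \<union> {\<kappa> Right1, \<kappa> Right2}"
  by (auto simp: inner_chain_def off_nodes_def leaves_def)

lemma mset_set_parts:
  assumes "L \<subseteq> {\<kappa> Left1, \<kappa> Left2}" "S \<subseteq> inner_chain n \<kappa>" "R \<subseteq> {\<kappa> Right1, \<kappa> Right2}"
  shows "mset_set (L \<union> S \<union> R) = mset_set L + mset_set S + mset_set R"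
proof -
  have "finite L" "finite R" "finite S"
    using assms by (auto intro: finite_subset simp: inner_chain_def)
  moreover have "L \<inter> S = {}" "(L \<union> S) \<inter> R = {}" using assms leaves_inner_disjoint by blast+
  ultimately show ?thesis by (simp add: mset_set_Union)
qed

lemma off_nodes_decomposition:
  assumes S: "S \<subseteq> \<kappa> ` off_nodes n"
  shows "mset_set S = mset_set (S \<inter> {\<kappa> Left1, \<kappa> Left2}) + mset_set (S \<inter> inner_chain n \<kappa>) +
    mset_set (S \<inter> {\<kappa> Right1, \<kappa> Right2})"
proof -
  have "S = (S \<inter> {\<kappa> Left1, \<kappa> Left2}) \<union> (S \<inter> inner_chain n \<kappa>) \<union> (S \<inter> {\<kappa> Right1, \<kappa> Right2})"
    using S off_nodes_image by blast
  then show ?thesis by (metis mset_set_parts inf_le2)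
qed

text \<open>The support is cut into its left, inner and right pieces, and failing to lie in the
  inner chain means that an outer piece is nonempty. Only the case of leaves solely on the right
  calls for the flipped labelling.\<close>

lemma leaves_classification:
  assumes R: "R = mset_set S" "S \<subseteq> \<kappa> ` off_nodes n" "\<not> S \<subseteq> inner_chain n \<kappa>"
  shows "\<exists>\<kappa>' \<in> {\<kappa>, \<kappa> \<circ> flip n}. leaves_left_only isec n \<kappa>' R \<or> leaves_both_ends isec n \<kappa>' R"
proof -
  define L where "L = S \<inter> {\<kappa> Left1, \<kappa> Left2}"
  define M where "M = mset_set (S \<inter> inner_chain n \<kappa>)"
  define D where "D = S \<inter> {\<kappa> Right1, \<kappa> Right2}"
  have fin: "finite S" by (rule finite_subset[OF R(2)]) (simp add: off_nodes_def leaves_def)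
  have eq: "R = mset_set L + M + mset_set D"
    using off_nodes_decomposition[OF R(2)] by (simp add: R(1) L_def M_def D_def)
  have M: "subchain_sum isec n \<kappa> M" unfolding M_def by (rule subchain_sum_mset_set) simp
  have fits: "has_type isec M (type_A_sum ls) \<Longrightarrow> fits n ls" for ls
    using has_type_A_sum_fits[of M ls] fin by (simp add: M_def)
  have left: "has_left_leaf \<kappa> R \<longleftrightarrow> L \<noteq> {}" and right: "has_right_leaf \<kappa> R \<longleftrightarrow> D \<noteq> {}"
    using fin by (auto simp: has_left_leaf_def has_right_leaf_def R(1) L_def D_def)
  have Lp: "L \<noteq> {} \<Longrightarrow> mset_set L \<in> left_parts \<kappa>"
    and Dp: "D \<noteq> {} \<Longrightarrow> mset_set D \<in> right_parts \<kappa>"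
    by (auto simp: left_parts_eq right_parts_eq L_def D_def)
  have "L \<noteq> {} \<or> D \<noteq> {}" using R(2,3) off_nodes_image by (auto simp: L_def D_def)
  then consider "L \<noteq> {}" "D = {}" | "L = {}" "D \<noteq> {}" | "L \<noteq> {}" "D \<noteq> {}" by blast
  then show ?thesis
  proof cases
    case 1
    then have "leaves_left_only isec n \<kappa> R"
      unfolding leaves_left_only_def using left right Lp M fits eq by auto
    then show ?thesis by blast
  next
    case 2
    \<comment> \<open>Under the flipped labelling the right leaves become left leaves, so
      \<open>D\<close> takes the place of \<open>L\<close>.\<close>
    have "left_parts (\<kappa> \<circ> flip n) = right_parts \<kappa>" by (simp add: left_parts_def right_parts_def)
    moreover have "has_left_leaf (\<kappa> \<circ> flip n) R" "\<not> has_right_leaf (\<kappa> \<circ> flip n) R"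
      using 2 left right by (auto simp: has_left_leaf_def has_right_leaf_def)
    moreover have "R = mset_set D + M" using eq 2 by simp
    ultimately have "leaves_left_only isec n (\<kappa> \<circ> flip n) R"
      unfolding leaves_left_only_def using 2 Dp subchain_sum_flip[OF M] fits by auto
    then show ?thesis by blast
  next
    case 3
    then have "leaves_both_ends isec n \<kappa> R"
      unfolding leaves_both_ends_def using left right Lp Dp M fits eq by blast
    then show ?thesis by blast
  qed
qed

lemma ADER_parts:
  assumes "subchain_sum isec n \<kappa> M" "B\<^sub>L \<in> left_parts \<kappa>" "B\<^sub>R \<in> right_parts \<kappa>"
  shows "M \<noteq> {#} \<Longrightarrow> ADER isec F M" "ADER isec F (B\<^sub>L + M)" "ADER isec F (M + B\<^sub>R)"
    "ADER isec F (B\<^sub>L + M + B\<^sub>R)"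
proof -
  obtain S where S: "S \<subseteq> inner_chain n \<kappa>" "M = mset_set S"
    using assms(1) by (rule subchain_sum_cases)
  obtain L where L: "L \<subseteq> {\<kappa> Left1, \<kappa> Left2}" "L \<noteq> {}" "B\<^sub>L = mset_set L"
    using assms(2) by (auto simp: left_parts_eq)
  obtain D where D: "D \<subseteq> {\<kappa> Right1, \<kappa> Right2}" "D \<noteq> {}" "B\<^sub>R = mset_set D"
    using assms(3) by (auto simp: right_parts_eq)
  \<comment> \<open>Allowing \<open>L'\<close> or \<open>D'\<close> to be empty covers all four
    divisors at once.\<close>
  have *: "ADER isec F (mset_set L' + M + mset_set D')"
    if "L' \<subseteq> {\<kappa> Left1, \<kappa> Left2}" "D' \<subseteq> {\<kappa> Right1, \<kappa> Right2}" "L' \<union> S \<union> D' \<noteq> {}" for L' D'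
    unfolding S(2) mset_set_parts[OF that(1) S(1) that(2), symmetric]
    using that S(1) by (intro ADER_mset_set) (auto simp: off_nodes_image)
  show "M \<noteq> {#} \<Longrightarrow> ADER isec F M" using *[of "{}" "{}"] S(2) by (cases "S = {}") auto
  show "ADER isec F (B\<^sub>L + M)" using *[of L "{}"] L by auto
  show "ADER isec F (M + B\<^sub>R)" using *[of "{}" D] D by auto
  show "ADER isec F (B\<^sub>L + M + B\<^sub>R)" using *[of L D] L D by auto
qed

end

theorem proposition11p2:
  fixes isec :: "'c \<Rightarrow> 'c \<Rightarrow> int" and n :: nat and \<kappa> :: "vertex \<Rightarrow> 'c" and F :: "'c divisor"
  assumes "n \<ge> 1" and "I_star_fiber isec n \<kappa> F"
  shows
    "(\<forall>R. ADER isec F R \<and> \<kappa> (Chain 0) \<notin> set_mset R \<and> \<kappa> (Chain n) \<notin> set_mset R \<longrightarrow>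
        (\<forall>K \<in> components isec (set_mset R). \<exists>k. is_dynkin isec K (TypeA k)) \<and>
        (set_mset R \<subseteq> inner_chain n \<kappa> \<longrightarrow>
           (\<exists>ls. (\<forall>l \<in> set ls. l \<ge> 1) \<and> has_type isec R (type_A_sum ls) \<and> fits n ls)) \<and>
        (\<not> set_mset R \<subseteq> inner_chain n \<kappa> \<longrightarrow>
           (\<exists>\<kappa>' \<in> {\<kappa>, \<kappa> \<circ> flip n}.
              leaves_left_only isec n \<kappa>' R \<or> leaves_both_ends isec n \<kappa>' R)))
     \<and>
     (\<forall>M B\<^sub>L B\<^sub>R.
        subchain_sum isec n \<kappa> M \<and>
        (M \<noteq> {#} \<longrightarrow>
           (\<exists>ls. (\<forall>l \<in> set ls. l \<ge> 1) \<and> has_type isec M (type_A_sum ls) \<and> fits n ls)) \<and>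
        B\<^sub>L \<in> left_parts \<kappa> \<and> B\<^sub>R \<in> right_parts \<kappa> \<longrightarrow>
        (M \<noteq> {#} \<longrightarrow> ADER isec F M) \<and>
        ADER isec F (B\<^sub>L + M) \<and>
        ADER isec F (M + B\<^sub>R) \<and>
        ADER isec F (B\<^sub>L + M + B\<^sub>R))"
proof -
  have classification: "(\<forall>K \<in> components isec (set_mset R). \<exists>k. is_dynkin isec K (TypeA k)) \<and>
      (set_mset R \<subseteq> inner_chain n \<kappa> \<longrightarrow>
         (\<exists>ls. (\<forall>l \<in> set ls. l \<ge> 1) \<and> has_type isec R (type_A_sum ls) \<and> fits n ls)) \<and>
      (\<not> set_mset R \<subseteq> inner_chain n \<kappa> \<longrightarrow>
         (\<exists>\<kappa>' \<in> {\<kappa>, \<kappa> \<circ> flip n}.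
            leaves_left_only isec n \<kappa>' R \<or> leaves_both_ends isec n \<kappa>' R))"
    if R: "ADER isec F R" "\<kappa> (Chain 0) \<notin># R" "\<kappa> (Chain n) \<notin># R" for R
  proof -
    note S = ADER_off_nodes[OF assms(2) R]
    note A = component_type_A[OF assms(2) S(1)]
    show ?thesis
      using A has_type_A_sum_exists[OF A] has_type_A_sum_fits[OF assms(2)]
        leaves_classification[OF assms(2) S(2,1)] by blast
  qed
  show ?thesis (is "?A \<and> ?B")
  proof
    show ?A by (intro allI impI, elim conjE, rule classification)
    show ?B
      by (intro allI impI, elim conjE)
        (intro conjI impI; rule ADER_parts[OF assms(2)]; assumption)
  qed
qed

end
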